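(* Let $V$ and $W$ be finite-dimensional real inner product spaces and let $T:V\to W$ be linear. Then a linear operator $S:W\to V$ is the pseudoinverse of $T$ if and only if $S$ satisfies $$(ST)^*=ST,\qquad (TS)^*=TS,\qquad TST=T,\qquad STS=S.$$
   Context: $V=\mathbb{R}^m$ with inner product $(x,y)=x^TH_1y$ and $W=\mathbb{R}^n$ with inner product $\langle z,w\rangle=z^TH_2w$, where $H_1,H_2$ are symmetric positive definite matrices. All adjoints are taken with respect to these inner products: for linear $T:V\to W$, the adjoint $T^*:W\to V$ is defined by $(x,T^*z)=\langle Tx,z\rangle$ for all $x\in V,z\in W$; similarly for operators $V\to V$ and $W\to W$. The pseudoinverse of $T$ is the operator $T^+:W\to V$ defined by $T^+=\lim_{\delta\to0}(T^*T+\delta^2I)^{-1}T^*$ (this limit always exists). *)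

theory Defs
  imports "HOL-Analysis.Analysis"
begin

text \<open>
  The inner product is an explicit parameter rather than the one of the type class
  \<^class>\<open>real_inner\<close>: a vector space such as \<open>real ^ 'm\<close> is to be considered with
  arbitrary inner products \<open>x\<^sup>T H y\<close>, not only with its dot product.
  The trivial space is allowed.
\<close>

locale fin_dim_inner_product_space =
  fixes ip :: "'v::real_vector \<Rightarrow> 'v \<Rightarrow> real"
  assumes bilinear_ip: "bilinear ip"
    and ip_commute: "ip x y = ip y x"
    and ip_pos: "x \<noteq> 0 \<Longrightarrow> ip x x > 0"
    and fin_dim: "\<exists>B :: 'v set. finite B \<and> span B = UNIV"

lemma fin_dim_inner_product_space_inner:
  "fin_dim_inner_product_space (inner :: 'a::euclidean_space \<Rightarrow> 'a \<Rightarrow> real)"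
proof
  show "bilinear (inner :: 'a \<Rightarrow> 'a \<Rightarrow> real)"
    by (simp add: bilinear_def bounded_linear_inner_left bounded_linear_inner_right
        bounded_linear.linear)
  show "\<exists>B :: 'a set. finite B \<and> span B = UNIV"
    using finite_Basis span_Basis by blast
qed (auto simp: inner_commute)

lemma fin_dim_inner_product_space_matrix:
  fixes H :: "real ^ 'm ^ 'm"
  assumes "transpose H = H" and "\<And>x. x \<noteq> 0 \<Longrightarrow> x \<bullet> (H *v x) > 0"
  shows "fin_dim_inner_product_space (\<lambda>x y. x \<bullet> (H *v y))"
proof
  show "bilinear (\<lambda>x y. x \<bullet> (H *v y))"
    by (auto simp: bilinear_def intro!: linearI
        simp: inner_add_left inner_add_right matrix_vector_right_distrib
          matrix_vector_mult_scaleR)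
  show "x \<bullet> (H *v y) = y \<bullet> (H *v x)" for x y
    by (metis assms(1) dot_lmul_matrix inner_commute vector_transpose_matrix)
  show "\<exists>B :: (real ^ 'm) set. finite B \<and> span B = UNIV"
    using finite_Basis span_Basis by blast
qed (use assms in auto)

definition ip_norm :: "('v \<Rightarrow> 'v \<Rightarrow> real) \<Rightarrow> 'v \<Rightarrow> real" where
  "ip_norm ip x = sqrt (ip x x)"

definition ip_adjoint ::
  "('v \<Rightarrow> 'v \<Rightarrow> real) \<Rightarrow> ('w \<Rightarrow> 'w \<Rightarrow> real) \<Rightarrow> ('v \<Rightarrow> 'w) \<Rightarrow> 'w \<Rightarrow> 'v" where
  "ip_adjoint ipV ipW T = (THE T'. \<forall>x z. ipV x (T' z) = ipW (T x) z)"

text \<open>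
  \<open>op_tendsto ipV ipW R S F\<close>: the operators \<open>R \<delta>\<close> from \<open>W\<close> to \<open>V\<close> converge to \<open>S\<close>
  along the filter \<open>F\<close> in the operator norm, i.e. for every \<open>\<epsilon> > 0\<close> the operator norm of
  \<open>R \<delta> - S\<close> is eventually at most \<open>\<epsilon>\<close>.
\<close>

definition op_tendsto ::
  "('v::real_vector \<Rightarrow> 'v \<Rightarrow> real) \<Rightarrow> ('w \<Rightarrow> 'w \<Rightarrow> real) \<Rightarrow>
    ('d \<Rightarrow> 'w \<Rightarrow> 'v) \<Rightarrow> ('w \<Rightarrow> 'v) \<Rightarrow> 'd filter \<Rightarrow> bool" where
  "op_tendsto ipV ipW R S F \<longleftrightarrow>
    (\<forall>\<epsilon>>0. \<forall>\<^sub>F \<delta> in F. \<forall>z. ip_norm ipV (R \<delta> z - S z) \<le> \<epsilon> * ip_norm ipW z)"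

text \<open>
  For \<open>\<delta> \<noteq> 0\<close> the operator \<open>T\<^sup>*T + \<delta>\<^sup>2I\<close> is bijective, so that \<^const>\<open>inv\<close> below is its
  genuine inverse; the filter \<open>at 0\<close> excludes \<open>\<delta> = 0\<close>.
\<close>

definition pseudoinverse ::
  "('v::real_vector \<Rightarrow> 'v \<Rightarrow> real) \<Rightarrow> ('w::real_vector \<Rightarrow> 'w \<Rightarrow> real) \<Rightarrow>
    ('v \<Rightarrow> 'w) \<Rightarrow> 'w \<Rightarrow> 'v" where
  "pseudoinverse ipV ipW T =
    (THE S. linear S \<and>
      op_tendsto ipV ipW
        (\<lambda>\<delta>::real. inv (\<lambda>x. ip_adjoint ipV ipW T (T x) + \<delta>\<^sup>2 *\<^sub>R x) \<circ> ip_adjoint ipV ipW T)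
        S (at 0))"

end

theory Submission
  imports Defs
begin

text \<open>
  Call a linear \<open>S\<close> satisfying the four equations a Penrose inverse of \<open>T\<close>. The theorem follows
  from two facts.

  First, a Penrose inverse exists: project \<open>W\<close> orthogonally onto the range of \<open>T\<close> and pick preimages
  orthogonal to the kernel of \<open>T\<close> (\<open>penrose_inverse_exists\<close>).

  Second, \<^emph>\<open>every\<close> Penrose inverse \<open>S\<close> is the limit of the operators
  \<open>(T\<^sup>*T + \<delta>\<^sup>2I)\<inverse>T\<^sup>*\<close> (\<open>penrose_inverse_is_limit\<close>). Indeed \<open>T\<^sup>*T S = T\<^sup>*(T S)\<^sup>* = (T S T)\<^sup>* = T\<^sup>*\<close>, and
  \<open>S z = S T S z = (S T)\<^sup>*S z = T\<^sup>* y\<close> with \<open>y = S\<^sup>*S z\<close>, so the error \<open>e = (T\<^sup>*T + \<delta>\<^sup>2I)\<inverse>T\<^sup>*z - S z\<close> solves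
  \<open>(T\<^sup>*T + \<delta>\<^sup>2I) e = - \<delta>\<^sup>2 T\<^sup>* y\<close>. Pairing with \<open>e\<close> gives
  \<open>\<parallel>T e\<parallel>\<^sup>2 + \<delta>\<^sup>2\<parallel>e\<parallel>\<^sup>2 = - \<delta>\<^sup>2\<langle>T e, y\<rangle> \<le> \<parallel>T e\<parallel>\<^sup>2 + \<delta>\<^sup>4\<parallel>y\<parallel>\<^sup>2/4\<close>,
  hence \<open>\<parallel>e\<parallel> \<le> \<bar>\<delta>\<bar>\<parallel>y\<parallel>/2 = O(\<bar>\<delta>\<bar>)\<parallel>z\<parallel>\<close>.

  Limits being unique, every Penrose inverse equals the pseudoinverse; since a Penrose inverse
  exists, the pseudoinverse is one.
\<close>

section \<open>Orthonormal bases and the Riesz representation\<close>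

context fin_dim_inner_product_space
begin

lemma linear_left: "linear (\<lambda>x. ip x y)" and linear_right: "linear (ip x)"
  using bilinear_ip by (auto simp: bilinear_def)

lemmas ip_simps =
  linear_add[OF linear_left] linear_diff[OF linear_left] linear_cmul[OF linear_left]
  linear_0[OF linear_left] linear_neg[OF linear_left] linear_sum[OF linear_left]
  linear_add[OF linear_right] linear_diff[OF linear_right] linear_cmul[OF linear_right]
  linear_0[OF linear_right] linear_neg[OF linear_right] linear_sum[OF linear_right]

lemma ip_nonneg: "0 \<le> ip x x"
  using ip_pos[of x] by (cases "x = 0") (auto simp: ip_simps)

lemma ip_self_eq_0: "ip x x = 0 \<longleftrightarrow> x = 0"
  using ip_pos[of x] by (cases "x = 0") (auto simp: ip_simps)

lemma ip_ext:
  assumes "\<And>x. ip x y = ip x z"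
  shows "y = z"
  using assms[of "y - z"] ip_self_eq_0[of "y - z"] by (simp add: ip_simps)

definition orthonormal :: "'v set \<Rightarrow> bool" where
  "orthonormal U \<longleftrightarrow> (\<forall>u\<in>U. \<forall>v\<in>U. ip u v = (if u = v then 1 else 0))"

lemma ip_orthonormal_sum:
  assumes "finite U" "orthonormal U" "v \<in> U"
  shows "ip (\<Sum>u\<in>U. c u *\<^sub>R u) v = c v"
proof -
  have "ip (\<Sum>u\<in>U. c u *\<^sub>R u) v = (\<Sum>u\<in>U. c u * ip u v)"
    by (simp add: ip_simps)
  also have "\<dots> = (\<Sum>u\<in>U. if u = v then c u else 0)"
    using assms by (intro sum.cong) (auto simp: orthonormal_def)
  also have "\<dots> = c v" using assms by simp
  finally show ?thesis .
qed

lemma orthonormal_expansion: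
  assumes "finite U" "orthonormal U" "x \<in> span U"
  shows "(\<Sum>u\<in>U. ip x u *\<^sub>R u) = x"
proof -
  obtain c where c: "x = (\<Sum>u\<in>U. c u *\<^sub>R u)"
    using assms(1,3) by (auto simp: span_finite)
  have "ip x u = c u" if "u \<in> U" for u
    using ip_orthonormal_sum[OF assms(1,2) that] c by simp
  then show ?thesis using c by simp
qed

text \<open>
  Gram--Schmidt: a new vector \<open>b\<close> loses its projection \<open>p\<close> onto the span so far, and the remainder
  is normalised.
\<close>

lemma orthonormal_basis_span:
  assumes "finite B"
  shows "\<exists>U. finite U \<and> orthonormal U \<and> span U = span B"
  using assms
proof induction
  case empty
  show ?case by (rule exI[of _ "{}"]) (simp add: orthonormal_def)
next
  case (insert b B)
  then obtain U where U: "finite U" "orthonormal U" "span U = span B" by blast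
  show ?case
  proof (cases "b \<in> span B")
    case True
    then show ?thesis using U by (metis span_redundant)
  next
    case False
    define p where "p = (\<Sum>u\<in>U. ip b u *\<^sub>R u)"
    define v where "v = b - p"
    define n where "n = (1 / sqrt (ip v v)) *\<^sub>R v"
    have p: "p \<in> span U"
      unfolding p_def by (intro span_sum span_mul span_base)
    then have "v \<noteq> 0" using False U by (auto simp: v_def)
    then have vv: "ip v v > 0" by (rule ip_pos)
    have orth: "ip v u = 0" if "u \<in> U" for u
      using ip_orthonormal_sum[OF U(1,2) that, of "ip b"]
      by (simp add: v_def p_def ip_simps(1,2))
    have nu: "ip n u = 0" "ip u n = 0" if "u \<in> U" for u
      using orth[OF that] ip_commute[of u v] by (simp_all add: n_def ip_simps)
    have nn: "ip n n = 1"
      using vv by (simp add: n_def ip_simps field_simps)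
    have "orthonormal (insert n U)"
      using U(2) nu nn by (auto simp: orthonormal_def)
    moreover have "span (insert n U) = span (insert b B)"
    proof -
      have "span (insert n U) = span (insert v U)"
      proof
        show "span (insert n U) \<subseteq> span (insert v U)"
          by (intro span_minimal subspace_span)
            (auto simp: n_def intro: span_mul span_base)
        have "v = sqrt (ip v v) *\<^sub>R n" using vv by (simp add: n_def)
        then have "v \<in> span (insert n U)"
          by (metis insertI1 span_base span_mul)
        then show "span (insert v U) \<subseteq> span (insert n U)"
          by (intro span_minimal subspace_span) (auto intro: span_base)
      qed
      also have "\<dots> = span (insert b U)"
        by (intro eq_span_insert_eq) (use p in \<open>simp add: v_def span_neg\<close>)
      also have "\<dots> = span (insert b B)"
        using U(3) by (metis span_insert)
      finally show ?thesis .
    qed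
    ultimately show ?thesis using U(1) by (metis finite.insertI)
  qed
qed

lemma orthonormal_basis_subspace:
  assumes "subspace X"
  shows "\<exists>U. finite U \<and> orthonormal U \<and> span U = X"
proof -
  obtain B where B: "B \<subseteq> X" "independent B" "X \<subseteq> span B"
    using maximal_independent_subset by metis
  obtain C :: "'v set" where "finite C" "span C = UNIV"
    using fin_dim by blast
  then have "finite B"
    using independent_span_bound[of C B] B(2) by auto
  moreover have "span B = X"
    using B assms by (metis span_minimal subset_antisym)
  ultimately show ?thesis using orthonormal_basis_span by metis
qed

lemma orthonormal_basis:
  obtains U where "finite U" "orthonormal U" "span U = UNIV"
  using orthonormal_basis_subspace[OF subspace_UNIV] by blast

lemma riesz:
  fixes f :: "'v \<Rightarrow> real"
  assumes "linear f"
  shows "\<exists>y. \<forall>x. ip x y = f x"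
proof -
  obtain U where U: "finite U" "orthonormal U" "span U = UNIV"
    using orthonormal_basis .
  have "ip x (\<Sum>u\<in>U. f u *\<^sub>R u) = f x" for x
  proof -
    have "f x = f (\<Sum>u\<in>U. ip x u *\<^sub>R u)"
      using orthonormal_expansion[OF U(1,2)] U(3) by simp
    also have "\<dots> = (\<Sum>u\<in>U. ip x u * f u)"
      by (simp add: linear_sum[OF assms] linear_cmul[OF assms])
    finally show ?thesis by (simp add: ip_simps mult.commute)
  qed
  then show ?thesis by blast
qed

lemma orthogonal_projection:
  assumes "subspace X"
  shows "\<exists>p\<in>X. \<forall>x\<in>X. ip (v - p) x = 0"
proof -
  obtain U where U: "finite U" "orthonormal U" "span U = X"
    using orthonormal_basis_subspace[OF assms] by blast
  define p where "p = (\<Sum>u\<in>U. ip v u *\<^sub>R u)"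
  have "p \<in> X"
    unfolding p_def U(3)[symmetric] by (intro span_sum span_mul span_base)
  moreover have "ip (v - p) x = 0" if "x \<in> X" for x
  proof (rule span_induct[of x U "\<lambda>x. ip (v - p) x = 0"])
    show "x \<in> span U" using that U by simp
    show "subspace {x. ip (v - p) x = 0}"
      by (rule linear_subspace_kernel[OF linear_right])
    show "ip (v - p) u = 0" if "u \<in> U" for u
      using ip_orthonormal_sum[OF U(1,2) that, of "ip v"]
      by (simp add: p_def ip_simps(2))
  qed
  ultimately show ?thesis by blast
qed

section \<open>Estimates for the quadratic form\<close>

lemma ip_add_le: "ip (x + y) (x + y) \<le> 2 * ip x x + 2 * ip y y"
  using ip_nonneg[of "x - y"] by (simp add: ip_simps ip_commute[of y x])

text \<open>The completed square that absorbs the cross term of the error equation into \<open>ip x x\<close>.\<close>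

lemma ip_young: "- (c * ip x y) \<le> ip x x + c\<^sup>2 / 4 * ip y y"
  using ip_nonneg[of "x + (c / 2) *\<^sub>R y"]
  by (simp add: ip_simps ip_commute[of y x] power2_eq_square field_simps)

text \<open>
  The exponential constant is harmless: the bound only serves to show that linear operators on
  finite-dimensional spaces are bounded.
\<close>

lemma ip_sum_le:
  assumes "finite I"
  shows "ip (\<Sum>i\<in>I. f i) (\<Sum>i\<in>I. f i) \<le> 2 ^ card I * (\<Sum>i\<in>I. ip (f i) (f i))"
  using assms
proof induction
  case empty
  then show ?case by (simp add: ip_simps)
next
  case (insert j I)
  have "ip (\<Sum>i\<in>insert j I. f i) (\<Sum>i\<in>insert j I. f i)
      \<le> 2 * ip (f j) (f j) + 2 * ip (\<Sum>i\<in>I. f i) (\<Sum>i\<in>I. f i)"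
    using ip_add_le[of "f j" "\<Sum>i\<in>I. f i"] insert.hyps by simp
  also have "\<dots> \<le> 2 * 2 ^ card I * ip (f j) (f j) + 2 * (2 ^ card I * (\<Sum>i\<in>I. ip (f i) (f i)))"
    using insert.IH mult_right_mono[of 1 "2 ^ card I :: real" "ip (f j) (f j)"] ip_nonneg[of "f j"]
    by simp
  also have "\<dots> = 2 ^ card (insert j I) * (\<Sum>i\<in>insert j I. ip (f i) (f i))"
    using insert.hyps by (simp add: algebra_simps)
  finally show ?case .
qed

end

locale inner_product_space_pair =
  V: fin_dim_inner_product_space ipV + W: fin_dim_inner_product_space ipW
  for ipV :: "'v::real_vector \<Rightarrow> 'v \<Rightarrow> real" and ipW :: "'w::real_vector \<Rightarrow> 'w \<Rightarrow> real"
begin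

lemma linear_operator_bounded:
  assumes "linear R"
  shows "\<exists>C\<ge>0. \<forall>x. ipW (R x) (R x) \<le> C * ipV x x"
proof -
  obtain U where U: "finite U" "V.orthonormal U" "span U = UNIV"
    using V.orthonormal_basis .
  define K where "K = (\<Sum>u\<in>U. ipW (R u) (R u))"
  have "ipW (R x) (R x) \<le> (2 ^ card U * K) * ipV x x" for x
  proof -
    have x: "(\<Sum>u\<in>U. ipV x u *\<^sub>R u) = x"
      using V.orthonormal_expansion[OF U(1,2)] U(3) by simp
    have "ipV x x = ipV x (\<Sum>u\<in>U. ipV x u *\<^sub>R u)" using x by simp
    also have "\<dots> = (\<Sum>u\<in>U. (ipV x u)\<^sup>2)" by (simp add: V.ip_simps power2_eq_square)
    finally have parseval: "ipV x x = (\<Sum>u\<in>U. (ipV x u)\<^sup>2)" .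
    have "R x = R (\<Sum>u\<in>U. ipV x u *\<^sub>R u)" using x by simp
    then have Rx: "R x = (\<Sum>u\<in>U. ipV x u *\<^sub>R R u)"
      by (simp add: linear_sum[OF assms] linear_cmul[OF assms])
    have "ipW (R x) (R x) \<le> 2 ^ card U * (\<Sum>u\<in>U. (ipV x u)\<^sup>2 * ipW (R u) (R u))"
      using W.ip_sum_le[OF U(1), of "\<lambda>u. ipV x u *\<^sub>R R u"]
      by (simp add: Rx W.ip_simps(3,9) power2_eq_square mult.assoc)
    also have "(\<Sum>u\<in>U. (ipV x u)\<^sup>2 * ipW (R u) (R u)) \<le> (\<Sum>u\<in>U. (ipV x u)\<^sup>2 * K)"
      using U(1) unfolding K_def
      by (intro sum_mono mult_left_mono member_le_sum W.ip_nonneg) auto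
    also have "\<dots> = K * ipV x x" by (simp add: parseval sum_distrib_left mult.commute)
    finally show ?thesis by (simp add: mult.assoc)
  qed
  moreover have "0 \<le> 2 ^ card U * K"
    unfolding K_def by (intro mult_nonneg_nonneg sum_nonneg W.ip_nonneg) auto
  ultimately show ?thesis by blast
qed

section \<open>Adjoints\<close>

lemma adjoint_eq_iff:
  assumes "linear T"
  shows "ip_adjoint ipV ipW T = T' \<longleftrightarrow> (\<forall>x z. ipV x (T' z) = ipW (T x) z)"
proof -
  have "\<exists>y. \<forall>x. ipV x y = ipW (T x) z" for z
    using V.riesz[of "\<lambda>x. ipW (T x) z"] linear_compose[OF assms W.linear_left[of z]]
    by (simp add: o_def)
  then obtain T0 where T0: "\<And>x z. ipV x (T0 z) = ipW (T x) z" by metis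
  have unique: "T1 = T0" if "\<forall>x z. ipV x (T1 z) = ipW (T x) z" for T1
    using that T0 by (intro ext V.ip_ext) simp
  have "ip_adjoint ipV ipW T = T0"
    unfolding ip_adjoint_def by (rule the_equality) (use T0 unique in auto)
  then show ?thesis using T0 unique by metis
qed

lemma ip_adjoint:
  assumes "linear T"
  shows "ipV x (ip_adjoint ipV ipW T z) = ipW (T x) z"
  using adjoint_eq_iff[OF assms] by blast

text \<open>
  The form \<open>\<langle>Tx, Ty\<rangle> + \<delta>\<^sup>2(x, y)\<close> is again an inner product on \<open>V\<close>, so the Riesz representation with
  respect to it solves \<open>(T\<^sup>*T + \<delta>\<^sup>2I) y = v\<close>.
\<close>

lemma regularised_surj:
  assumes "linear T" "\<delta> \<noteq> 0"
  shows "surj (\<lambda>x. ip_adjoint ipV ipW T (T x) + \<delta>\<^sup>2 *\<^sub>R x)"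
proof -
  interpret T: linear T by fact
  define b where "b = (\<lambda>x y. ipW (T x) (T y) + \<delta>\<^sup>2 * ipV x y)"
  have "fin_dim_inner_product_space b"
  proof
    show "bilinear b"
      by (auto simp: bilinear_def b_def T.add T.scale V.ip_simps W.ip_simps algebra_simps
          intro!: linearI)
    show "b x y = b y x" for x y
      by (simp add: b_def V.ip_commute[of x y] W.ip_commute[of "T x" "T y"])
    show "b x x > 0" if "x \<noteq> 0" for x
      using V.ip_pos[OF that] W.ip_nonneg[of "T x"] assms(2)
      by (simp add: b_def add_nonneg_pos)
    show "\<exists>B :: 'v set. finite B \<and> span B = UNIV" by (rule V.fin_dim)
  qed
  then interpret b: fin_dim_inner_product_space b .
  have "\<exists>y. v = ip_adjoint ipV ipW T (T y) + \<delta>\<^sup>2 *\<^sub>R y" for v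
  proof -
    obtain y where y: "\<And>x. b x y = ipV x v"
      using b.riesz[OF V.linear_left] by blast
    have "ipV x v = ipV x (ip_adjoint ipV ipW T (T y) + \<delta>\<^sup>2 *\<^sub>R y)" for x
      using y[of x] by (simp add: V.ip_simps ip_adjoint[OF assms(1)] b_def)
    then show ?thesis using V.ip_ext by blast
  qed
  then show ?thesis unfolding surj_def by blast
qed

section \<open>Penrose inverses\<close>

text \<open>
  Self-adjointness is stated through the inner products, so that it can be used by rewriting inside
  them; \<open>adjoint_eq_iff\<close> translates it into equations between operators.
\<close>

definition penrose_inverse :: "('v \<Rightarrow> 'w) \<Rightarrow> ('w \<Rightarrow> 'v) \<Rightarrow> bool" where
  "penrose_inverse T S \<longleftrightarrow>
    (\<forall>x y. ipV x (S (T y)) = ipV (S (T x)) y) \<and>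
    (\<forall>z w. ipW z (T (S w)) = ipW (T (S z)) w) \<and>
    (\<forall>x. T (S (T x)) = T x) \<and> (\<forall>z. S (T (S z)) = S z)"

text \<open>
  With an orthonormal basis \<open>U\<close> of the range and preimages \<open>g u\<close> orthogonal to the kernel, put
  \<open>S z = (\<Sum>u\<in>U. \<langle>z, u\<rangle> g u)\<close>. Then \<open>T S\<close> is the orthogonal projection onto the range and
  \<open>S T\<close> the one onto the orthogonal complement of the kernel.
\<close>

lemma penrose_inverse_exists:
  assumes "linear T"
  shows "\<exists>S. linear S \<and> penrose_inverse T S"
proof -
  interpret T: linear T by fact
  obtain U where U: "finite U" "W.orthonormal U" "span U = range T"
    using W.orthonormal_basis_subspace[OF linear_subspace_image[OF assms subspace_UNIV]] by blast
  have "\<exists>g. T g = u \<and> (\<forall>x. T x = 0 \<longrightarrow> ipV g x = 0)" if u: "u \<in> U" for u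
  proof -
    obtain h where h: "u = T h" using u U(3) span_base by blast
    obtain p where "T p = 0" "\<And>x. T x = 0 \<Longrightarrow> ipV (h - p) x = 0"
      using V.orthogonal_projection[OF linear_subspace_kernel[OF assms], of h] by auto
    then show ?thesis using h by (intro exI[of _ "h - p"]) (simp add: T.diff)
  qed
  then obtain g where Tg: "\<And>u. u \<in> U \<Longrightarrow> T (g u) = u"
    and g_orth: "\<And>u x. u \<in> U \<Longrightarrow> T x = 0 \<Longrightarrow> ipV (g u) x = 0"
    by metis
  define S where "S z = (\<Sum>u\<in>U. ipW z u *\<^sub>R g u)" for z
  have linS: "linear S"
    by (rule linearI)
      (simp_all add: S_def W.ip_simps scaleR_add_left sum.distrib scaleR_sum_right)
  have TS: "T (S z) = (\<Sum>u\<in>U. ipW z u *\<^sub>R u)" for z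
    by (simp add: S_def T.sum T.scale Tg)
  have TST: "T (S (T x)) = T x" for x
    unfolding TS using U by (intro W.orthonormal_expansion) auto
  have S_orth: "ipV (S z) x = 0" if "T x = 0" for z x
    using g_orth[OF _ that] by (simp add: S_def V.ip_simps)
  have STS: "S (T (S z)) = S z" for z
  proof -
    have "ipW (T (S z)) u = ipW z u" if "u \<in> U" for u
      unfolding TS by (rule W.ip_orthonormal_sum[OF U(1,2) that])
    then have "(\<Sum>u\<in>U. ipW (T (S z)) u *\<^sub>R g u) = (\<Sum>u\<in>U. ipW z u *\<^sub>R g u)"
      by (intro sum.cong) auto
    then show ?thesis by (simp only: S_def[symmetric])
  qed
  have TS_sym: "ipW z (T (S w)) = ipW (T (S z)) w" for z w
    by (simp add: TS W.ip_simps W.ip_commute[of _ w] mult.commute)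
  have ST: "ipV (S (T x)) y = ipV (S (T x)) (S (T y))" for x y
    using S_orth[of "y - S (T y)" "T x"] by (simp add: T.diff TST V.ip_simps)
  have ST_sym: "ipV x (S (T y)) = ipV (S (T x)) y" for x y
    using ST[of x y] ST[of y x] V.ip_commute by metis
  show ?thesis
    using linS TST STS TS_sym ST_sym unfolding penrose_inverse_def by blast
qed

section \<open>The regularised limit\<close>

text \<open>
  The estimate \<open>\<parallel>e\<parallel>\<^sup>2 \<le> \<delta>\<^sup>2/4 \<parallel>S\<^sup>*S z\<parallel>\<^sup>2\<close> for the error \<open>e\<close> at \<open>z\<close>; boundedness of
  \<open>S\<^sup>*S\<close> makes it uniform in \<open>z\<close>, as convergence in operator norm demands.
\<close>

lemma penrose_inverse_is_limit:
  assumes linT: "linear T" and linS: "linear S" and S: "penrose_inverse T S"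
  shows "op_tendsto ipV ipW
    (\<lambda>\<delta>::real. inv (\<lambda>x. ip_adjoint ipV ipW T (T x) + \<delta>\<^sup>2 *\<^sub>R x) \<circ> ip_adjoint ipV ipW T) S (at 0)"
proof -
  interpret T: linear T by fact
  interpret WV: inner_product_space_pair ipW ipV ..
  interpret WW: inner_product_space_pair ipW ipW ..
  have TST: "T (S (T x)) = T x" and STS: "S (T (S z)) = S z"
    and ST_sym: "ipV x (S (T y)) = ipV (S (T x)) y"
    and TS_sym: "ipW z (T (S w)) = ipW (T (S z)) w" for x y z w
    using S unfolding penrose_inverse_def by blast+
  define A where "A \<delta> x = ip_adjoint ipV ipW T (T x) + \<delta>\<^sup>2 *\<^sub>R x" for \<delta> :: real and x
  define S' where "S' = ip_adjoint ipW ipV S"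
  have S': "ipW z (S' x) = ipV (S z) x" for z x
    unfolding S'_def by (rule WV.ip_adjoint[OF linS])
  have "linear S'"
    by (intro linearI W.ip_ext) (simp_all add: S' W.ip_simps V.ip_simps)
  then have "linear (\<lambda>z. S' (S z))"
    using linear_compose[OF linS] by (simp add: o_def)
  then obtain C where C: "C \<ge> 0" "\<And>z. ipW (S' (S z)) (S' (S z)) \<le> C * ipW z z"
    using WW.linear_operator_bounded by blast
  have error: "ipV e e \<le> \<delta>\<^sup>2 / 4 * (C * ipW z z)"
    if "\<delta> \<noteq> 0" and e: "e = inv (A \<delta>) (ip_adjoint ipV ipW T z) - S z" for \<delta> z e
  proof -
    define r where "r = inv (A \<delta>) (ip_adjoint ipV ipW T z)"
    have "surj (A \<delta>)"
      using regularised_surj[OF linT that(1)] by (simp add: A_def[abs_def])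
    then have "A \<delta> r = ip_adjoint ipV ipW T z"
      unfolding r_def by (rule surj_f_inv_f)
    then have "ipV e (A \<delta> r) = ipW (T e) z"
      by (simp add: ip_adjoint[OF linT])
    then have r: "ipW (T e) (T r) + \<delta>\<^sup>2 * ipV e r = ipW (T e) z"
      by (simp add: A_def V.ip_simps ip_adjoint[OF linT])
    have TS: "ipW (T e) (T (S z)) = ipW (T e) z"
      by (simp add: TS_sym TST)
    have "ipV e (S z) = ipV e (S (T (S z)))" by (simp add: STS)
    also have "\<dots> = ipV (S (T e)) (S z)" by (rule ST_sym)
    finally have Sz: "ipV e (S z) = ipW (T e) (S' (S z))" by (simp add: S')
    have er: "e = r - S z" by (simp add: e r_def)
    have "ipW (T e) (T e) = ipW (T e) (T r) - ipW (T e) (T (S z))"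
      by (subst (2) er) (simp add: T.diff W.ip_simps)
    moreover have "ipV e e = ipV e r - ipV e (S z)"
      by (subst (2) er) (simp add: V.ip_simps)
    then have "\<delta>\<^sup>2 * ipV e e = \<delta>\<^sup>2 * ipV e r - \<delta>\<^sup>2 * ipW (T e) (S' (S z))"
      by (simp add: Sz right_diff_distrib)
    ultimately have "ipW (T e) (T e) + \<delta>\<^sup>2 * ipV e e = - (\<delta>\<^sup>2 * ipW (T e) (S' (S z)))"
      using r TS by linarith
    also have "\<dots> \<le> ipW (T e) (T e) + (\<delta>\<^sup>2)\<^sup>2 / 4 * ipW (S' (S z)) (S' (S z))"
      by (rule W.ip_young)
    finally have "\<delta>\<^sup>2 * ipV e e \<le> \<delta>\<^sup>2 * (\<delta>\<^sup>2 / 4 * ipW (S' (S z)) (S' (S z)))"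
      by (simp add: power2_eq_square mult.assoc)
    then have "ipV e e \<le> \<delta>\<^sup>2 / 4 * ipW (S' (S z)) (S' (S z))"
      by (rule mult_left_le_imp_le) (use that(1) in simp)
    also have "\<dots> \<le> \<delta>\<^sup>2 / 4 * (C * ipW z z)"
      by (intro mult_left_mono C) simp
    finally show ?thesis .
  qed
  have "op_tendsto ipV ipW (\<lambda>\<delta>. inv (A \<delta>) \<circ> ip_adjoint ipV ipW T) S (at 0)"
    unfolding op_tendsto_def
  proof (intro allI impI)
    fix \<epsilon> :: real
    assume "\<epsilon> > 0"
    have "((\<lambda>\<delta>. \<delta>\<^sup>2 / 4 * C) \<longlongrightarrow> 0\<^sup>2 / 4 * C) (at (0::real))"
      by (intro tendsto_intros) simp
    then have "\<forall>\<^sub>F \<delta> in at 0. \<delta>\<^sup>2 / 4 * C < \<epsilon>\<^sup>2"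
      using \<open>\<epsilon> > 0\<close> by (auto dest!: order_tendstoD(2)[where a = "\<epsilon>\<^sup>2"])
    moreover have "\<forall>\<^sub>F \<delta> in at (0::real). \<delta> \<noteq> 0"
      by (rule eventually_neq_at_within)
    ultimately show "\<forall>\<^sub>F \<delta> in at 0. \<forall>z. ip_norm ipV ((inv (A \<delta>) \<circ> ip_adjoint ipV ipW T) z - S z)
        \<le> \<epsilon> * ip_norm ipW z"
    proof eventually_elim
      case (elim \<delta>)
      show ?case
      proof
        fix z
        let ?e = "inv (A \<delta>) (ip_adjoint ipV ipW T z) - S z"
        have "ipV ?e ?e \<le> (\<delta>\<^sup>2 / 4 * C) * ipW z z"
          using error[OF elim(2) refl] by (simp add: mult.assoc)
        also have "\<dots> \<le> \<epsilon>\<^sup>2 * ipW z z"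
          using elim(1) W.ip_nonneg by (intro mult_right_mono) auto
        finally have "sqrt (ipV ?e ?e) \<le> sqrt (\<epsilon>\<^sup>2 * ipW z z)" by simp
        then show "ip_norm ipV ((inv (A \<delta>) \<circ> ip_adjoint ipV ipW T) z - S z) \<le> \<epsilon> * ip_norm ipW z"
          using \<open>\<epsilon> > 0\<close> by (simp add: ip_norm_def real_sqrt_mult)
      qed
    qed
  qed
  then show ?thesis by (simp add: A_def[abs_def])
qed

lemma op_tendsto_unique:
  assumes "op_tendsto ipV ipW R S F" "op_tendsto ipV ipW R S' F" "F \<noteq> bot"
  shows "S = S'"
proof
  fix z
  have sq: "ipV x x \<le> \<epsilon>\<^sup>2 * ipW z z" if "ip_norm ipV x \<le> \<epsilon> * ip_norm ipW z" for x and \<epsilon> :: real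
  proof -
    have "(ip_norm ipV x)\<^sup>2 \<le> (\<epsilon> * ip_norm ipW z)\<^sup>2"
      using that V.ip_nonneg by (intro power_mono) (auto simp: ip_norm_def)
    then show ?thesis
      by (simp add: ip_norm_def power_mult_distrib V.ip_nonneg W.ip_nonneg)
  qed
  have bound: "ipV (S z - S' z) (S z - S' z) \<le> 4 * \<epsilon>\<^sup>2 * ipW z z" if "\<epsilon> > 0" for \<epsilon> :: real
  proof -
    have "\<forall>\<^sub>F \<delta> in F. ip_norm ipV (R \<delta> z - S z) \<le> \<epsilon> * ip_norm ipW z \<and>
        ip_norm ipV (R \<delta> z - S' z) \<le> \<epsilon> * ip_norm ipW z"
      using assms(1,2) that unfolding op_tendsto_def
      by (intro eventually_conj) (fastforce elim: eventually_mono)+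
    then obtain \<delta> where "ip_norm ipV (R \<delta> z - S z) \<le> \<epsilon> * ip_norm ipW z"
        "ip_norm ipV (R \<delta> z - S' z) \<le> \<epsilon> * ip_norm ipW z"
      using eventually_happens'[OF assms(3)] by blast
    then have "ipV (R \<delta> z - S z) (R \<delta> z - S z) \<le> \<epsilon>\<^sup>2 * ipW z z"
        "ipV (R \<delta> z - S' z) (R \<delta> z - S' z) \<le> \<epsilon>\<^sup>2 * ipW z z"
      by (auto intro: sq)
    moreover have "ipV (S z - R \<delta> z) (S z - R \<delta> z) = ipV (R \<delta> z - S z) (R \<delta> z - S z)"
      by (simp add: V.ip_simps)
    ultimately show ?thesis
      using V.ip_add_le[of "R \<delta> z - S' z" "S z - R \<delta> z"] by simp
  qed
  have "((\<lambda>\<epsilon>. 4 * \<epsilon>\<^sup>2 * ipW z z) \<longlongrightarrow> 4 * 0\<^sup>2 * ipW z z) (at_right (0::real))"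
    by (intro tendsto_intros)
  then have "ipV (S z - S' z) (S z - S' z) \<le> 4 * 0\<^sup>2 * ipW z z"
    by (rule tendsto_lowerbound) (auto intro!: bound eventually_at_right_less[THEN eventually_mono])
  then show "S z = S' z"
    using V.ip_nonneg[of "S z - S' z"] V.ip_self_eq_0[of "S z - S' z"] by simp
qed

lemma penrose_inverse_eq_pseudoinverse:
  assumes "linear T" "linear S" "penrose_inverse T S"
  shows "pseudoinverse ipV ipW T = S"
  unfolding pseudoinverse_def
proof (rule the_equality)
  show "linear S \<and> op_tendsto ipV ipW
      (\<lambda>\<delta>::real. inv (\<lambda>x. ip_adjoint ipV ipW T (T x) + \<delta>\<^sup>2 *\<^sub>R x) \<circ> ip_adjoint ipV ipW T) S (at 0)"
    using assms penrose_inverse_is_limit by blast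
  then show "S' = S" if "linear S' \<and> op_tendsto ipV ipW
      (\<lambda>\<delta>::real. inv (\<lambda>x. ip_adjoint ipV ipW T (T x) + \<delta>\<^sup>2 *\<^sub>R x) \<circ> ip_adjoint ipV ipW T) S' (at 0)" for S'
    using that op_tendsto_unique at_neq_bot by blast
qed

end

theorem theorem35:
  fixes ipV :: "'v::real_vector \<Rightarrow> 'v \<Rightarrow> real"
    and ipW :: "'w::real_vector \<Rightarrow> 'w \<Rightarrow> real"
    and T :: "'v \<Rightarrow> 'w" and S :: "'w \<Rightarrow> 'v"
  assumes "fin_dim_inner_product_space ipV"
    and "fin_dim_inner_product_space ipW"
    and "linear T"
    and "linear S"
  shows "S = pseudoinverse ipV ipW T \<longleftrightarrow>
    ip_adjoint ipV ipV (S \<circ> T) = S \<circ> T \<and>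
    ip_adjoint ipW ipW (T \<circ> S) = T \<circ> S \<and>
    T \<circ> S \<circ> T = T \<and>
    S \<circ> T \<circ> S = S"
proof -
  interpret V: fin_dim_inner_product_space ipV by fact
  interpret W: fin_dim_inner_product_space ipW by fact
  interpret inner_product_space_pair ipV ipW ..
  interpret VV: inner_product_space_pair ipV ipV ..
  interpret WW: inner_product_space_pair ipW ipW ..
  have "S = pseudoinverse ipV ipW T \<longleftrightarrow> penrose_inverse T S"
    using penrose_inverse_eq_pseudoinverse penrose_inverse_exists assms(3,4) by metis
  also have "\<dots> \<longleftrightarrow> ip_adjoint ipV ipV (S \<circ> T) = S \<circ> T \<and> ip_adjoint ipW ipW (T \<circ> S) = T \<circ> S \<and>
      T \<circ> S \<circ> T = T \<and> S \<circ> T \<circ> S = S"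
    using VV.adjoint_eq_iff[OF linear_compose[OF assms(3,4)]]
      WW.adjoint_eq_iff[OF linear_compose[OF assms(4,3)]]
    by (simp add: penrose_inverse_def fun_eq_iff)
  finally show ?thesis .
qed

end
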